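(* Let $n\geq 4$ and $0\le p\le 1$. In the $n$-dimensional bubble-sort network $B_n$ under the random node fault model in which each node is fault-free independently with probability $p$, $$P(2,2,0)=\tfrac{1}{4}(n^8-8n^7+30n^6-69n^5+104n^4-99n^3+53n^2-12n)p^{4(n-2)!}+(n^7-8n^6+29n^5-59n^4+68n^3-41n^2+10n)p^{4(n-2)!-(n-3)!}+\tfrac{1}{2}(3n^6-23n^5+67n^4-92n^3+59n^2-14n)p^{4(n-2)!-2(n-3)!}+(n^4-6n^3+11n^2-6n)p^{4(n-2)!-3(n-3)!}+\tfrac{1}{4}(n^5-10n^4+35n^3-50n^2+24n)p^{4(n-2)!-4(n-3)!}.$$
   Context: Let $N_n=\{1,\dots,n\}$. The bubble-sort network $B_n$ has as vertices the permutations of $N_n$, written as strings $u_1u_2\cdots u_n$, two permutations being adjacent iff they differ by swapping two adjacent positions $u_i,u_{i+1}$. For distinct $a_1,a_2\in N_n$, a $B_{n-2}$-subnetwork of $B_n$ is one of the following vertex sets (each inducing a copy of $B_{n-2}$ and having $(n-2)!$ vertices): $a_1a_2X^{n-2}$, the set of permutations with $u_1=a_1,u_2=a_2$ ("prefix form"); $a_1X^{n-2}a_2$, the set with $u_1=a_1,u_n=a_2$ ("middle form"); $X^{n-2}a_1a_2$, the set with $u_{n-1}=a_1,u_n=a_2$ ("suffix form"). Each form gives $n(n-1)$ subnetworks. In the random node fault model each vertex is fault-free independently with probability $p$ (faulty with probability $1-p$); a subnetwork is fault-free if all its vertices are. For nonnegative integers $i,j,k$ with $i+j+k=4$, $P(i,j,k)$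 denotes the sum, over all sets $S$ of four distinct $B_{n-2}$-subnetworks consisting of $i$ of prefix form, $j$ of middle form and $k$ of suffix form, of the probability that all four members of $S$ are fault-free, i.e. of $p^{|\bigcup_{H\in S}H|}$. (The paper calls $P(i,j,k)$ "the probability that there are four fault-free $B_{n-2}$'s, $i$ of which are of prefix form, $j$ of middle form and $k$ of suffix form".) *)

theory Defs
  imports "HOL-Probability.Probability" "HOL-Combinatorics.Multiset_Permutations"
begin

(* The string u_1 u_2 ... u_n is a list, so u_i is u ! (i - 1). *)
definition bubble_sort_nodes :: "nat \<Rightarrow> nat list set" where
  "bubble_sort_nodes n = permutations_of_set {1..n}"

(* Node faults do not interact with the links, so the adjacency only records which network
   is meant; the quantities below depend on its node set alone. *)
definition bubble_sort_adj :: "nat \<Rightarrow> nat list \<Rightarrow> nat list \<Rightarrow> bool" where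
  "bubble_sort_adj n u v \<longleftrightarrow> u \<in> bubble_sort_nodes n \<and> v \<in> bubble_sort_nodes n \<and>
     (\<exists>i. Suc i < n \<and> v = u[i := u ! Suc i, Suc i := u ! i])"

definition prefix_subnet :: "nat \<Rightarrow> nat \<Rightarrow> nat \<Rightarrow> nat list set" where
  "prefix_subnet n a b = {u \<in> bubble_sort_nodes n. u ! 0 = a \<and> u ! 1 = b}"

definition middle_subnet :: "nat \<Rightarrow> nat \<Rightarrow> nat \<Rightarrow> nat list set" where
  "middle_subnet n a b = {u \<in> bubble_sort_nodes n. u ! 0 = a \<and> u ! (n - 1) = b}"

definition suffix_subnet :: "nat \<Rightarrow> nat \<Rightarrow> nat \<Rightarrow> nat list set" where
  "suffix_subnet n a b = {u \<in> bubble_sort_nodes n. u ! (n - 2) = a \<and> u ! (n - 1) = b}"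

definition prefix_subnets :: "nat \<Rightarrow> nat list set set" where
  "prefix_subnets n = {prefix_subnet n a b | a b. a \<in> {1..n} \<and> b \<in> {1..n} \<and> a \<noteq> b}"

definition middle_subnets :: "nat \<Rightarrow> nat list set set" where
  "middle_subnets n = {middle_subnet n a b | a b. a \<in> {1..n} \<and> b \<in> {1..n} \<and> a \<noteq> b}"

definition suffix_subnets :: "nat \<Rightarrow> nat list set set" where
  "suffix_subnets n = {suffix_subnet n a b | a b. a \<in> {1..n} \<and> b \<in> {1..n} \<and> a \<noteq> b}"

(* Outcomes are functions assigning True to the fault-free nodes; the second argument of Pi_pmf
   is the dummy value taken outside the node set. *)
definition node_fault_model :: "nat \<Rightarrow> real \<Rightarrow> (nat list \<Rightarrow> bool) pmf" where
  "node_fault_model n p = Pi_pmf (bubble_sort_nodes n) False (\<lambda>_. bernoulli_pmf p)"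

definition fault_free :: "(nat list \<Rightarrow> bool) \<Rightarrow> nat list set \<Rightarrow> bool" where
  "fault_free \<omega> H \<longleftrightarrow> (\<forall>u\<in>H. \<omega> u)"

(* For n >= 4 the three forms have no member in common, so the card S condition is then implied by the other three. *)
definition subnet_selections :: "nat \<Rightarrow> nat \<Rightarrow> nat \<Rightarrow> nat \<Rightarrow> nat list set set set" where
  "subnet_selections n i j k =
     {S. S \<subseteq> prefix_subnets n \<union> middle_subnets n \<union> suffix_subnets n \<and> card S = i + j + k \<and>
         card (S \<inter> prefix_subnets n) = i \<and> card (S \<inter> middle_subnets n) = j \<and>
         card (S \<inter> suffix_subnets n) = k}"

(* A sum of probabilities of events that need not be disjoint, hence not itself a probability. *)
definition fault_free_sum :: "nat \<Rightarrow> real \<Rightarrow> nat \<Rightarrow> nat \<Rightarrow> nat \<Rightarrow> real" where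
  "fault_free_sum n p i j k =
     (\<Sum>S\<in>subnet_selections n i j k.
        measure_pmf.prob (node_fault_model n p) {\<omega>. \<forall>H\<in>S. fault_free \<omega> H})"

end

theory Submission
  imports Defs
begin

text \<open>
  Distinct subnetworks of the same form are disjoint, and the prefix subnetwork of \<open>(a, b)\<close> meets
  the middle subnetwork of \<open>(c, d)\<close> iff \<open>a = c\<close> and \<open>b \<noteq> d\<close>, in \<open>(n - 3)!\<close> permutations. Hence the
  union of two prefix and two middle subnetworks has \<open>4 (n - 2)! - e (n - 3)!\<close> elements, where \<open>e\<close> is
  the number of overlapping pairs. To count the selections with given \<open>e\<close>, fix the two prefix
  subnetworks and sort the middle ones by how many of the two they meet. The sizes of these classes
  depend only on whether the two prefix subnetworks share their first symbol.
\<close>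

section \<open>Sums over two-element sets and over ordered pairs sorted by level\<close>

text \<open>Every two-element set comes from exactly two ordered pairs, so grouping the ordered sum
  by its unordered pair counts each \<open>F T\<close> twice.\<close>

lemma sum_two_subsets:
  fixes F :: "'a set \<Rightarrow> real"
  assumes "finite A"
  shows "(\<Sum>T | T \<subseteq> A \<and> card T = 2. F T) = 1/2 * (\<Sum>x\<in>A. \<Sum>y\<in>A - {x}. F {x, y})"
proof -
  let ?S = "SIGMA x:A. A - {x}"
  let ?T = "{T. T \<subseteq> A \<and> card T = 2}"
  let ?g = "\<lambda>z. {fst z, snd z}"
  have "(\<Sum>x\<in>A. \<Sum>y\<in>A - {x}. F {x, y}) = (\<Sum>z\<in>?S. F (?g z))"
    using assms by (simp add: sum.Sigma case_prod_unfold)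
  also have "\<dots> = (\<Sum>T\<in>?T. \<Sum>z | z \<in> ?S \<and> ?g z = T. F (?g z))"
    by (rule sum.group[symmetric]) (use assms in \<open>auto simp: card_insert_if\<close>)
  also have "\<dots> = (\<Sum>T\<in>?T. 2 * F T)"
  proof (rule sum.cong[OF refl])
    fix T assume "T \<in> ?T"
    then obtain u v where T: "T = {u, v}" "u \<noteq> v" and "u \<in> A" "v \<in> A"
      by (auto simp: card_2_iff)
    then have "{z. z \<in> ?S \<and> ?g z = T} = {(u, v), (v, u)}"
      by (auto simp: doubleton_eq_iff)
    then show "(\<Sum>z | z \<in> ?S \<and> ?g z = T. F (?g z)) = 2 * F T"
      using T by (simp add: insert_commute)
  qed
  finally show ?thesis by (simp add: sum_distrib_left[symmetric])
qed

text \<open>Used to pass from sets of subnetworks to their parameters: by injectivity, removing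
  \<open>f x\<close> from the image amounts to removing \<open>x\<close> from
  \<open>A\<close>.\<close>

lemma sum_two_subsets_image:
  fixes F :: "'b set \<Rightarrow> real"
  assumes "finite A" "inj_on f A"
  shows "(\<Sum>T | T \<subseteq> f ` A \<and> card T = 2. F T) = 1/2 * (\<Sum>x\<in>A. \<Sum>y\<in>A - {x}. F {f x, f y})"
proof -
  have "f ` A - {f x} = f ` (A - {x})" if "x \<in> A" for x
    using that assms(2) by (auto simp: inj_on_def)
  then show ?thesis
    using assms by (simp add: sum_two_subsets sum.reindex inj_on_diff cong: sum.cong)
qed

text \<open>With \<open>m0\<close>, \<open>m1\<close>, \<open>m2\<close> elements on levels 0, 1, 2,
  there are \<open>mi * mj\<close> ordered pairs from two different levels and
  \<open>mi * (mi - 1)\<close> pairs of distinct elements from one level. The total 2 arises both as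
  1 + 1 and as 0 + 2 in either order. The equation for \<open>m0\<close> is stated over the reals to
  avoid truncated subtraction.\<close>

lemma sum_distinct_pairs_by_level:
  fixes w :: "nat \<Rightarrow> real"
  assumes "finite A" and "\<And>x. x \<in> A \<Longrightarrow> f x \<le> 2"
    and m1: "card {x\<in>A. f x = 1} = m1" and m2: "card {x\<in>A. f x = 2} = m2"
    and m0: "real m0 = real (card A) - real m1 - real m2"
  shows "(\<Sum>x\<in>A. \<Sum>y\<in>A - {x}. w (f x + f y)) =
    m0 * (real m0 - 1) * w 0 + 2 * m0 * m1 * w 1 + (m1 * (real m1 - 1) + 2 * m0 * m2) * w 2
      + 2 * m1 * m2 * w 3 + m2 * (real m2 - 1) * w 4"
proof -
  have part: "A = {x\<in>A. f x = 0} \<union> {x\<in>A. f x = 1} \<union> {x\<in>A. f x = 2}"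
    using assms(2) by force
  have split: "sum g A = (\<Sum>x | x \<in> A \<and> f x = 0. g x) + (\<Sum>x | x \<in> A \<and> f x = 1. g x)
      + (\<Sum>x | x \<in> A \<and> f x = 2. g x)" for g :: "'a \<Rightarrow> real"
    using assms(1) by (subst part, subst sum.union_disjoint, simp, simp, force,
        subst sum.union_disjoint) auto
  have c0: "real (card {x\<in>A. f x = 0}) = m0"
    using split[of "\<lambda>_. 1"] m1 m2 m0 by simp
  have by_level: "(\<Sum>x\<in>A. g (f x)) = m0 * g 0 + m1 * g 1 + m2 * g 2" for g :: "nat \<Rightarrow> real"
    using split[of "\<lambda>x. g (f x)"] c0 m1 m2 by simp
  \<comment> \<open>Adding and subtracting the diagonal lets \<open>x\<close> and \<open>y\<close>
    range over the levels independently.\<close>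
  have "(\<Sum>x\<in>A. \<Sum>y\<in>A - {x}. w (f x + f y)) = (\<Sum>x\<in>A. (\<Sum>y\<in>A. w (f x + f y)) - w (f x + f x))"
    using assms(1) by (intro sum.cong) (auto simp: sum_diff1)
  also have "\<dots> = (\<Sum>x\<in>A. m0 * w (f x) + m1 * w (f x + 1) + m2 * w (f x + 2) - w (f x + f x))"
    by (simp add: by_level[of "\<lambda>i. w (_ + i)"])
  also have "\<dots> = m0 * (m0 * w 0 + m1 * w 1 + m2 * w 2 - w 0)
      + m1 * (m0 * w 1 + m1 * w 2 + m2 * w 3 - w 2) + m2 * (m0 * w 2 + m1 * w 3 + m2 * w 4 - w 4)"
    by (subst by_level[of "\<lambda>i. m0 * w i + m1 * w (i + 1) + m2 * w (i + 2) - w (i + i)"])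
      (simp add: numeral_eq_Suc)
  finally show ?thesis by (simp add: algebra_simps)
qed

section \<open>Counting overlaps among pairs of distinct symbols\<close>

definition distinct_pairs :: "'a set \<Rightarrow> ('a \<times> 'a) set" where
  "distinct_pairs X = {(a, b). a \<in> X \<and> b \<in> X \<and> a \<noteq> b}"

text \<open>Models the number of nodes shared by the prefix subnetwork of \<open>x\<close> and the
  middle subnetwork of \<open>y\<close>, in units of \<open>(n - 3)!\<close>. It is a number rather
  than a truth value so that overlaps can be added.\<close>

definition overlap :: "'a \<times> 'a \<Rightarrow> 'a \<times> 'a \<Rightarrow> nat" where
  "overlap x y = of_bool (fst x = fst y \<and> snd x \<noteq> snd y)"

lemma distinct_pairs_conv_Sigma: "distinct_pairs X = (SIGMA a:X. X - {a})"
  by (auto simp: distinct_pairs_def)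

lemma finite_distinct_pairs [simp]: "finite X \<Longrightarrow> finite (distinct_pairs X)"
  by (simp add: distinct_pairs_conv_Sigma)

lemma card_distinct_pairs: "finite X \<Longrightarrow> card (distinct_pairs X) = card X * (card X - 1)"
  by (simp add: distinct_pairs_conv_Sigma)

text \<open>For \<open>x = (a, b)\<close> and \<open>x' = (a, c)\<close>, the pair
  \<open>(a, b)\<close> meets only \<open>x'\<close> and \<open>(a, c)\<close> meets only
  \<open>x\<close>. Each of the n - 3 pairs \<open>(a, e)\<close> with \<open>e\<close> outside
  \<open>{a, b, c}\<close> meets both. This leaves n(n-1) - 2 - (n-3) = (n-1)^2 pairs that meet
  neither.\<close>

lemma sum_overlap_same_first:
  fixes w :: "nat \<Rightarrow> real"
  assumes X: "finite X" "card X \<ge> 3" and "x \<in> distinct_pairs X" "x' \<in> distinct_pairs X"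
    "x \<noteq> x'" "fst x = fst x'"
  defines "n \<equiv> real (card X)"
  shows "(\<Sum>y\<in>distinct_pairs X. \<Sum>y'\<in>distinct_pairs X - {y}.
            w (overlap x y + overlap x' y + (overlap x y' + overlap x' y'))) =
    (n-1)^2 * ((n-1)^2 - 1) * w 0 + 4 * (n-1)^2 * w 1 + (2 + 2 * (n-1)^2 * (n-3)) * w 2
      + 4 * (n-3) * w 3 + (n-3) * (n-4) * w 4"
proof -
  obtain a b c where x: "x = (a, b)" "x' = (a, c)" and abc: "a \<in> X" "b \<in> X" "c \<in> X"
    "a \<noteq> b" "a \<noteq> c" "b \<noteq> c"
    using assms by (cases x; cases x') (auto simp: distinct_pairs_def)
  let ?k = "\<lambda>y. overlap x y + overlap x' y"
  have "{y\<in>distinct_pairs X. ?k y = 1} = {(a, b), (a, c)}"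
    using abc by (auto simp: x overlap_def distinct_pairs_def split: if_splits)
  then have m1: "card {y\<in>distinct_pairs X. ?k y = 1} = 2" using abc by simp
  have "{y\<in>distinct_pairs X. ?k y = 2} = {a} \<times> (X - {a, b, c})"
    using abc by (auto simp: x overlap_def distinct_pairs_def of_bool_def split: if_splits)
  then have m2: "card {y\<in>distinct_pairs X. ?k y = 2} = card X - 3"
    using abc X by (simp add: card_cartesian_product)
  have "real ((card X - 1)^2) = real (card (distinct_pairs X)) - real 2 - real (card X - 3)"
    unfolding card_distinct_pairs[OF X(1)] using X
    by (simp add: of_nat_diff) (simp add: algebra_simps power2_eq_square)
  from sum_distinct_pairs_by_level[OF finite_distinct_pairs[OF X(1)] _ m1 m2 this, of w]
  show ?thesis
    using X by (simp add: overlap_def of_nat_diff n_def algebra_simps)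
qed

text \<open>No pair starts with two different symbols, so level 2 is empty and \<open>w 3\<close>,
  \<open>w 4\<close> do not occur. Each of \<open>x\<close>, \<open>x'\<close> is met by n - 2
  pairs, which leaves n(n-1) - 2(n-2) = n^2 - 3n + 4 pairs on level 0.\<close>

lemma sum_overlap_distinct_first:
  fixes w :: "nat \<Rightarrow> real"
  assumes X: "finite X" "card X \<ge> 2" and "x \<in> distinct_pairs X" "x' \<in> distinct_pairs X"
    "fst x \<noteq> fst x'"
  defines "n \<equiv> real (card X)"
  shows "(\<Sum>y\<in>distinct_pairs X. \<Sum>y'\<in>distinct_pairs X - {y}.
            w (overlap x y + overlap x' y + (overlap x y' + overlap x' y'))) =
    (n^2 - 3*n + 4) * (n^2 - 3*n + 3) * w 0 + 4 * (n^2 - 3*n + 4) * (n-2) * w 1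
      + 2 * (n-2) * (2*n-5) * w 2"
proof -
  obtain a b c d where x: "x = (a, b)" "x' = (c, d)" and abc: "a \<in> X" "b \<in> X" "c \<in> X" "d \<in> X"
    "a \<noteq> b" "c \<noteq> d" "a \<noteq> c"
    using assms by (cases x; cases x') (auto simp: distinct_pairs_def)
  let ?k = "\<lambda>y. overlap x y + overlap x' y"
  have "{y\<in>distinct_pairs X. ?k y = 1} = {a} \<times> (X - {a, b}) \<union> {c} \<times> (X - {c, d})"
    using abc by (auto simp: x overlap_def distinct_pairs_def split: if_splits)
  also have "card \<dots> = 2 * (card X - 2)"
    using abc X by (subst card_Un_disjoint) (auto simp: card_cartesian_product)
  finally have m1: "card {y\<in>distinct_pairs X. ?k y = 1} = 2 * (card X - 2)" .
  have "{y\<in>distinct_pairs X. ?k y = 2} = {}"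
    using abc by (auto simp: x overlap_def distinct_pairs_def of_bool_def split: if_splits)
  then have m2: "card {y\<in>distinct_pairs X. ?k y = 2} = 0" by (simp only: card.empty)
  \<comment> \<open>Ensures that the natural-number subtraction defining \<open>?m0\<close> is
    exact.\<close>
  have le: "2 * (card X - 2) \<le> card (distinct_pairs X)"
    unfolding m1[symmetric] by (rule card_mono) (use X in auto)
  let ?m0 = "card (distinct_pairs X) - 2 * (card X - 2)"
  have m0: "real ?m0 = real (card (distinct_pairs X)) - real (2 * (card X - 2)) - real 0"
    using le by (simp add: of_nat_diff)
  have val: "real ?m0 = n^2 - 3*n + 4"
    unfolding m0 using X by (simp add: card_distinct_pairs of_nat_diff algebra_simps power2_eq_square n_def)
  have v2: "real (2 * (card X - 2)) = 2 * (n - 2)" using X by (simp add: of_nat_diff n_def)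
  have "(\<Sum>y\<in>distinct_pairs X. \<Sum>y'\<in>distinct_pairs X - {y}. w (?k y + ?k y')) =
     (n^2 - 3*n + 4) * (n^2 - 3*n + 4 - 1) * w 0 + 2 * (n^2 - 3*n + 4) * (2 * (n - 2)) * w 1
     + (2 * (n - 2)) * (2 * (n - 2) - 1) * w 2"
    using sum_distinct_pairs_by_level[OF finite_distinct_pairs[OF X(1)] _ m1 m2 m0, of w]
    unfolding val v2 by (simp add: overlap_def)
  then show ?thesis by (simp add: algebra_simps)
qed

text \<open>For each of the n(n-1) choices of \<open>x\<close>, there are n - 2 other pairs with the
  same first symbol, contributing \<open>?U\<close> each. The remaining n(n-1) - 1 - (n-2) = (n-1)^2
  pairs contribute \<open>?V\<close> each.\<close>

lemma sum_overlap:
  fixes w :: "nat \<Rightarrow> real"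
  assumes X: "finite X" "card X \<ge> 3"
  defines "n \<equiv> real (card X)"
  shows "(\<Sum>x\<in>distinct_pairs X. \<Sum>x'\<in>distinct_pairs X - {x}.
            \<Sum>y\<in>distinct_pairs X. \<Sum>y'\<in>distinct_pairs X - {y}.
            w (overlap x y + overlap x' y + (overlap x y' + overlap x' y'))) =
    n * (n-1) * ((n-2) * ((n-1)^2 * ((n-1)^2 - 1) * w 0 + 4 * (n-1)^2 * w 1
        + (2 + 2 * (n-1)^2 * (n-3)) * w 2 + 4 * (n-3) * w 3 + (n-3) * (n-4) * w 4)
      + (n-1)^2 * ((n^2 - 3*n + 4) * (n^2 - 3*n + 3) * w 0 + 4 * (n^2 - 3*n + 4) * (n-2) * w 1
        + 2 * (n-2) * (2*n-5) * w 2))" (is "_ = n * (n-1) * ((n-2) * ?U + (n-1)^2 * ?V)")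
proof -
  let ?A = "distinct_pairs X"
  have cardA: "real (card ?A) = n * (n-1)"
    using X by (simp add: card_distinct_pairs of_nat_diff n_def)
  have "(\<Sum>x'\<in>?A - {x}. \<Sum>y\<in>?A. \<Sum>y'\<in>?A - {y}.
            w (overlap x y + overlap x' y + (overlap x y' + overlap x' y')))
      = (n-2) * ?U + (n-1)^2 * ?V" if x: "x \<in> ?A" for x
  proof -
    obtain a b where ab: "x = (a, b)" "a \<in> X" "b \<in> X" "a \<noteq> b"
      using x by (auto simp: distinct_pairs_def)
    let ?E = "(?A - {x}) \<inter> {x'. fst x' = a}" and ?D = "(?A - {x}) \<inter> - {x'. fst x' = a}"
    have "?E = {a} \<times> (X - {a, b})"
      using ab by (auto simp: distinct_pairs_def)
    then have E: "real (card ?E) = n - 2"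
      using ab X by (simp add: card_cartesian_product n_def of_nat_diff)
    have "card (?A - {x}) = card (?E \<union> ?D)"
      by (rule arg_cong[where f = card]) blast
    also have "\<dots> = card ?E + card ?D"
      by (rule card_Un_disjoint) (use X in auto)
    also have "card (?A - {x}) = card ?A - 1"
      using x by simp
    finally have "real (card ?A) = real (card ?E) + real (card ?D) + 1"
      using card_gt_0_iff[of ?A] x X by auto
    then have D: "real (card ?D) = (n - 1)^2"
      unfolding E cardA by (simp add: algebra_simps power2_eq_square)
    have "(\<Sum>x'\<in>?A - {x}. \<Sum>y\<in>?A. \<Sum>y'\<in>?A - {y}.
            w (overlap x y + overlap x' y + (overlap x y' + overlap x' y')))
       = (\<Sum>x'\<in>?A - {x}. if fst x' = a then ?U else ?V)"
    proof (rule sum.cong[OF refl])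
      fix x' assume "x' \<in> ?A - {x}"
      then have x': "x' \<in> ?A" "x \<noteq> x'" by auto
      show "(\<Sum>y\<in>?A. \<Sum>y'\<in>?A - {y}.
            w (overlap x y + overlap x' y + (overlap x y' + overlap x' y')))
          = (if fst x' = a then ?U else ?V)"
      proof (cases "fst x' = a")
        case True
        then have "fst x = fst x'" by (simp add: ab)
        from sum_overlap_same_first[OF X x x' this, of w] True show ?thesis
          by (simp only: if_True n_def simp_thms)
      next
        case False
        then have "fst x \<noteq> fst x'" by (simp add: ab)
        from sum_overlap_distinct_first[OF X(1) _ x x'(1) this, of w] X(2) False show ?thesis
          by (simp only: if_False n_def)
      qed
    qed
    also have "\<dots> = (n-2) * ?U + (n-1)^2 * ?V"
      unfolding E[symmetric] D[symmetric]
      by (subst sum.If_cases) (use X in simp_all)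
    finally show ?thesis .
  qed
  then have "(\<Sum>x\<in>?A. \<Sum>x'\<in>?A - {x}. \<Sum>y\<in>?A. \<Sum>y'\<in>?A - {y}.
      w (overlap x y + overlap x' y + (overlap x y' + overlap x' y')))
     = real (card ?A) * ((n-2) * ?U + (n-1)^2 * ?V)" by simp
  also note cardA
  finally show ?thesis .
qed

section \<open>Permutations with prescribed ends\<close>

lemma permutations_of_set_sandwich:
  assumes "distinct (xs @ zs)" "set (xs @ zs) \<subseteq> A"
  shows "{u \<in> permutations_of_set A. \<exists>ys. u = xs @ ys @ zs} =
    (\<lambda>ys. xs @ ys @ zs) ` permutations_of_set (A - set (xs @ zs))"
  using assms by (auto simp: permutations_of_set_def image_iff)

lemma card_permutations_of_set_sandwich:
  assumes "finite A" "distinct (xs @ zs)" "set (xs @ zs) \<subseteq> A"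
  shows "card {u \<in> permutations_of_set A. \<exists>ys. u = xs @ ys @ zs} =
    fact (card A - length (xs @ zs))"
proof -
  have "card (set (xs @ zs)) = length (xs @ zs)"
    using assms(2) by (rule distinct_card)
  then have "card (A - set (xs @ zs)) = card A - length (xs @ zs)"
    using assms by (simp add: card_Diff_subset)
  then show ?thesis
    using assms(1) unfolding permutations_of_set_sandwich[OF assms(2,3)]
    by (subst card_image) (auto simp: inj_on_def)
qed

lemma bubble_sort_nodes_length: "u \<in> bubble_sort_nodes n \<Longrightarrow> length u = n"
  by (metis bubble_sort_nodes_def length_finite_permutations_of_set card_atLeastAtMost diff_Suc_1)

lemma finite_bubble_sort_nodes [simp]: "finite (bubble_sort_nodes n)"
  by (simp add: bubble_sort_nodes_def)

lemma card_nodes_sandwich: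
  assumes "distinct (xs @ zs)" "set (xs @ zs) \<subseteq> {1..n}"
  shows "card {u \<in> bubble_sort_nodes n. \<exists>ys. u = xs @ ys @ zs} = fact (n - length (xs @ zs))"
  using card_permutations_of_set_sandwich[OF finite_atLeastAtMost assms]
  by (simp add: bubble_sort_nodes_def)

lemma ex_node_sandwich:
  assumes "distinct (xs @ zs)" "set (xs @ zs) \<subseteq> {1..n}"
  obtains ys where "xs @ ys @ zs \<in> bubble_sort_nodes n"
proof -
  have "card {u \<in> bubble_sort_nodes n. \<exists>ys. u = xs @ ys @ zs} \<noteq> 0"
    using card_nodes_sandwich[OF assms] by simp
  then have "{u \<in> bubble_sort_nodes n. \<exists>ys. u = xs @ ys @ zs} \<noteq> {}"
    by (metis card.empty)
  then show ?thesis using that by blast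
qed

lemma prefix_subnet_conv:
  assumes "n \<ge> 2"
  shows "prefix_subnet n a b = {u \<in> bubble_sort_nodes n. \<exists>ys. u = [a, b] @ ys @ []}"
proof -
  have "u ! 0 = a \<and> u ! 1 = b \<longleftrightarrow> (\<exists>ys. u = [a, b] @ ys @ [])" if "length u = n" for u
    using that assms by (cases u; cases "tl u") auto
  then show ?thesis unfolding prefix_subnet_def by (blast dest: bubble_sort_nodes_length)
qed

lemma middle_subnet_conv:
  assumes "n \<ge> 2"
  shows "middle_subnet n a b = {u \<in> bubble_sort_nodes n. \<exists>ys. u = [a] @ ys @ [b]}"
proof -
  have "u ! 0 = a \<and> u ! (n - 1) = b \<longleftrightarrow> (\<exists>ys. u = [a] @ ys @ [b])" if "length u = n" for u
    using that assms by (cases u; cases "tl u" rule: rev_cases) (auto simp: nth_append)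
  then show ?thesis unfolding middle_subnet_def by (blast dest: bubble_sort_nodes_length)
qed

text \<open>For \<open>n \<ge> 3\<close> the positions 1, 2 and n are different, so the intersection
  again has prescribed ends, now with n - 3 free positions.\<close>

lemma prefix_Int_middle_conv:
  assumes "n \<ge> 3"
  shows "prefix_subnet n a b \<inter> middle_subnet n a c =
    {u \<in> bubble_sort_nodes n. \<exists>ys. u = [a, b] @ ys @ [c]}"
proof -
  have "u ! 0 = a \<and> u ! 1 = b \<and> u ! (n - 1) = c \<longleftrightarrow> (\<exists>ys. u = [a, b] @ ys @ [c])"
    if "length u = n" for u
    using that assms
    by (cases u; cases "tl u"; cases "tl (tl u)" rule: rev_cases) (auto simp: nth_append)
  then show ?thesis unfolding prefix_subnet_def middle_subnet_def
    by (blast dest: bubble_sort_nodes_length)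
qed

section \<open>From probabilities to cardinalities of unions\<close>

text \<open>The event is a product set: the coordinates in the union must be \<open>True\<close> and
  all others are free. Independence then gives one factor \<open>p\<close> for each node of the
  union.\<close>

lemma prob_all_fault_free:
  assumes "0 \<le> p" "p \<le> 1" "\<Union>S \<subseteq> bubble_sort_nodes n"
  shows "measure_pmf.prob (node_fault_model n p) {\<omega>. \<forall>H\<in>S. fault_free \<omega> H} = p ^ card (\<Union>S)"
proof -
  let ?B = "\<lambda>u. if u \<in> \<Union>S then {True} else UNIV"
  have "{\<omega>. \<forall>H\<in>S. fault_free \<omega> H} = Pi (bubble_sort_nodes n) ?B"
    using assms(3) by (auto simp: fault_free_def Pi_def)
  then have "measure_pmf.prob (node_fault_model n p) {\<omega>. \<forall>H\<in>S. fault_free \<omega> H}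
      = (\<Prod>u\<in>bubble_sort_nodes n. measure_pmf.prob (bernoulli_pmf p) (?B u))"
    unfolding node_fault_model_def by (simp add: measure_Pi_pmf_Pi)
  also have "\<dots> = (\<Prod>u\<in>bubble_sort_nodes n. if u \<in> \<Union>S then p else 1)"
    using assms by (intro prod.cong) (auto simp: measure_pmf_single)
  also have "\<dots> = p ^ card (\<Union>S)"
  proof -
    have "bubble_sort_nodes n \<inter> {u. u \<in> \<Union>S} = \<Union>S"
      using assms(3) by blast
    then show ?thesis by (simp only: prod.If_cases finite_bubble_sort_nodes) simp
  qed
  finally show ?thesis .
qed

text \<open>Because \<open>A\<close>, \<open>B\<close> are disjoint and \<open>C\<close>,
  \<open>D\<close> are disjoint, the four cross intersections are pairwise disjoint.
  Inclusion-exclusion therefore has no triple terms.\<close>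

lemma card_Un_two_pairs:
  assumes "finite A" "finite B" "finite C" "finite D" "A \<inter> B = {}" "C \<inter> D = {}"
  shows "card (A \<union> B \<union> (C \<union> D)) = card A + card B + card C + card D
    - (card (A \<inter> C) + card (B \<inter> C) + (card (A \<inter> D) + card (B \<inter> D)))"
proof -
  have "(A \<union> B) \<inter> (C \<union> D) = ((A \<inter> C) \<union> (B \<inter> C)) \<union> ((A \<inter> D) \<union> (B \<inter> D))" by auto
  also have "card \<dots> = card (A \<inter> C) + card (B \<inter> C) + (card (A \<inter> D) + card (B \<inter> D))"
    using assms by (subst card_Un_disjoint; (auto; fail)?)+
  finally have "card ((A \<union> B) \<inter> (C \<union> D)) =
     card (A \<inter> C) + card (B \<inter> C) + (card (A \<inter> D) + card (B \<inter> D))" .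
  then show ?thesis
    using card_Un_Int[of "A \<union> B" "C \<union> D"] assms by (simp add: card_Un_disjoint)
qed

section \<open>Sizes, intersections and parametrisation of the subnetworks\<close>

lemma prefix_subnets_conv_image:
  "prefix_subnets n = case_prod (prefix_subnet n) ` distinct_pairs {1..n}"
  by (auto simp: prefix_subnets_def distinct_pairs_def)

lemma middle_subnets_conv_image:
  "middle_subnets n = case_prod (middle_subnet n) ` distinct_pairs {1..n}"
  by (auto simp: middle_subnets_def distinct_pairs_def)

lemma card_prefix_subnet:
  assumes "n \<ge> 2" "x \<in> distinct_pairs {1..n}"
  shows "card (case_prod (prefix_subnet n) x) = fact (n - 2)"
proof -
  obtain a b where "x = (a, b)" "a \<in> {1..n}" "b \<in> {1..n}" "a \<noteq> b"
    using assms(2) by (auto simp: distinct_pairs_def)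
  then show ?thesis
    using card_nodes_sandwich[of "[a, b]" "[]" n] prefix_subnet_conv[OF assms(1), of a b]
    by (simp add: numeral_2_eq_2)
qed

lemma card_middle_subnet:
  assumes "n \<ge> 2" "x \<in> distinct_pairs {1..n}"
  shows "card (case_prod (middle_subnet n) x) = fact (n - 2)"
proof -
  obtain a b where "x = (a, b)" "a \<in> {1..n}" "b \<in> {1..n}" "a \<noteq> b"
    using assms(2) by (auto simp: distinct_pairs_def)
  then show ?thesis
    using card_nodes_sandwich[of "[a]" "[b]" n] middle_subnet_conv[OF assms(1), of a b]
    by (simp add: numeral_2_eq_2)
qed

lemma card_prefix_Int_middle:
  assumes "n \<ge> 3" "x \<in> distinct_pairs {1..n}" "y \<in> distinct_pairs {1..n}"
  shows "card (case_prod (prefix_subnet n) x \<inter> case_prod (middle_subnet n) y)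
    = overlap x y * fact (n - 3)"
proof -
  obtain a b where x: "x = (a, b)" "a \<in> {1..n}" "b \<in> {1..n}" "a \<noteq> b"
    using assms(2) by (auto simp: distinct_pairs_def)
  obtain c d where y: "y = (c, d)" "c \<in> {1..n}" "d \<in> {1..n}" "c \<noteq> d"
    using assms(3) by (auto simp: distinct_pairs_def)
  show ?thesis
  proof (cases "a = c \<and> b \<noteq> d")
    case True
    then show ?thesis
      using x y card_nodes_sandwich[of "[a, b]" "[d]" n] prefix_Int_middle_conv[OF assms(1), of a b d]
      by (simp add: overlap_def numeral_3_eq_3)
  next
    case False
    \<comment> \<open>A symbol cannot stand in both the second and the last position, which excludes
      \<open>b = d\<close>; the case of different first symbols is immediate.\<close>
    have "u ! 1 \<noteq> u ! (n - 1)" if "u \<in> bubble_sort_nodes n" for u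
      using that assms(1) bubble_sort_nodes_length[OF that]
      by (auto simp: bubble_sort_nodes_def permutations_of_set_def nth_eq_iff_index_eq)
    then have "prefix_subnet n a b \<inter> middle_subnet n c d = {}"
      using False by (auto simp: prefix_subnet_def middle_subnet_def)
    then show ?thesis
      using False x y by (auto simp: overlap_def)
  qed
qed

lemma prefix_subnets_disjoint:
  "x \<noteq> y \<Longrightarrow> case_prod (prefix_subnet n) x \<inter> case_prod (prefix_subnet n) y = {}"
  by (auto simp: prefix_subnet_def split: prod.splits)

lemma middle_subnets_disjoint:
  "x \<noteq> y \<Longrightarrow> case_prod (middle_subnet n) x \<inter> case_prod (middle_subnet n) y = {}"
  by (auto simp: middle_subnet_def split: prod.splits)

text \<open>If \<open>f x = f y\<close> with \<open>x \<noteq> y\<close>, this set would be disjoint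
  from itself, hence empty. For the subnetworks, nonemptiness follows from their factorial
  size.\<close>

lemma inj_on_disjoint_nonempty:
  assumes "\<And>x y. x \<noteq> y \<Longrightarrow> f x \<inter> f y = {}" "\<And>x. x \<in> A \<Longrightarrow> f x \<noteq> {}"
  shows "inj_on f A"
  using assms by (metis inj_onI inf.idem)

lemma inj_on_prefix_subnet:
  "n \<ge> 2 \<Longrightarrow> inj_on (case_prod (prefix_subnet n)) (distinct_pairs {1..n})"
  by (rule inj_on_disjoint_nonempty[OF prefix_subnets_disjoint])
    (use card_prefix_subnet in \<open>force\<close>)+

lemma inj_on_middle_subnet:
  "n \<ge> 2 \<Longrightarrow> inj_on (case_prod (middle_subnet n)) (distinct_pairs {1..n})"
  by (rule inj_on_disjoint_nonempty[OF middle_subnets_disjoint])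
    (use card_middle_subnet in \<open>force\<close>)+

section \<open>The three forms have no subnetwork in common\<close>

text \<open>At least two symbols remain besides the two prescribed ones, and each of them occurs
  last in some member. Middle and suffix subnetworks have a constant last symbol, so this separates
  the prefix form from both.\<close>

lemma prefix_subnets_last_varies:
  assumes "n \<ge> 4" "H \<in> prefix_subnets n"
  shows "\<exists>u\<in>H. \<exists>v\<in>H. u ! (n - 1) \<noteq> v ! (n - 1)"
proof -
  obtain a b where ab: "H = prefix_subnet n a b" "a \<in> {1..n}" "b \<in> {1..n}" "a \<noteq> b"
    using assms(2) by (auto simp: prefix_subnets_def)
  have "card ({1..n} - {a, b}) = n - 2" using ab by simp
  then obtain C where "C \<subseteq> {1..n} - {a, b}" "card C = 2"
    using obtain_subset_with_card_n[of 2 "{1..n} - {a, b}"] assms(1)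
    by (metis add_le_imp_le_diff numeral_Bit0)
  then obtain c d where cd: "c \<noteq> d" "c \<in> {1..n} - {a, b}" "d \<in> {1..n} - {a, b}"
    by (auto simp: card_2_iff)
  have "\<exists>u\<in>H. u ! (n - 1) = e" if "e \<in> {1..n} - {a, b}" for e
  proof -
    have "card (prefix_subnet n a b \<inter> middle_subnet n a e) = fact (n - 3)"
      using card_prefix_Int_middle[of n "(a, b)" "(a, e)"] assms(1) ab that
      by (auto simp: distinct_pairs_def overlap_def)
    then have "prefix_subnet n a b \<inter> middle_subnet n a e \<noteq> {}"
      by (metis card.empty fact_nonzero)
    then show ?thesis by (auto simp: ab middle_subnet_def)
  qed
  with cd show ?thesis by metis
qed

lemma prefix_Int_middle_subnets: "n \<ge> 4 \<Longrightarrow> prefix_subnets n \<inter> middle_subnets n = {}"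
  using prefix_subnets_last_varies by (fastforce simp: middle_subnets_def middle_subnet_def)

lemma prefix_Int_suffix_subnets: "n \<ge> 4 \<Longrightarrow> prefix_subnets n \<inter> suffix_subnets n = {}"
  using prefix_subnets_last_varies by (fastforce simp: suffix_subnets_def suffix_subnet_def)

text \<open>Both forms fix the last symbol, so the first symbol has to separate them: it is constant
  on a middle subnetwork, while a suffix subnetwork has a member starting with any symbol
  \<open>e\<close> other than its two prescribed ones.\<close>

lemma middle_Int_suffix_subnets:
  assumes "n \<ge> 4"
  shows "middle_subnets n \<inter> suffix_subnets n = {}"
proof (rule ccontr)
  assume "middle_subnets n \<inter> suffix_subnets n \<noteq> {}"
  then obtain a b c d where ab: "a \<in> {1..n}" "b \<in> {1..n}" "a \<noteq> b"
    and H: "suffix_subnet n a b = middle_subnet n c d"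
    unfolding middle_subnets_def suffix_subnets_def by blast
  \<comment> \<open>Since \<open>c\<close> may coincide with \<open>a\<close> or \<open>b\<close>,
    only the bound 3 on the number of excluded symbols is available; \<open>n \<ge> 4\<close> still
    leaves one.\<close>
  have "card ({1..n} - {a, b, c}) \<ge> card {1..n} - card {a, b, c}"
    by (rule diff_card_le_card_Diff) simp
  moreover have "card {a, b, c} \<le> 3" by (simp add: card_insert_if)
  ultimately have "card ({1..n} - {a, b, c}) \<noteq> 0" using assms unfolding card_atLeastAtMost by linarith
  then have "{1..n} - {a, b, c} \<noteq> {}" by (metis card.empty)
  then obtain e where "e \<in> {1..n} - {a, b, c}" by blast
  then have e: "e \<in> {1..n}" "e \<noteq> a" "e \<noteq> b" "e \<noteq> c" by auto
  obtain ys where u: "[e] @ ys @ [a, b] \<in> bubble_sort_nodes n"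
    using ex_node_sandwich[of "[e]" "[a, b]" n] ab e by auto
  have "length ys = n - 3" using bubble_sort_nodes_length[OF u] by simp
  then have "[e] @ ys @ [a, b] \<in> suffix_subnet n a b"
    using u assms by (auto simp: suffix_subnet_def nth_append nth_Cons')
  then show False using H e by (auto simp: middle_subnet_def)
qed

section \<open>Reduction of the sum over selections to the overlap count\<close>

text \<open>As the forms are disjoint, a selection is recovered from its prefix part and its middle
  part.\<close>

lemma subnet_selections_220:
  assumes "n \<ge> 4"
  shows "bij_betw (\<lambda>(P, M). P \<union> M)
    ({P. P \<subseteq> prefix_subnets n \<and> card P = 2} \<times> {M. M \<subseteq> middle_subnets n \<and> card M = 2})
    (subnet_selections n 2 2 0)"
proof -
  note disj = prefix_Int_middle_subnets[OF assms] prefix_Int_suffix_subnets[OF assms]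
    middle_Int_suffix_subnets[OF assms]
  show ?thesis
  proof (rule bij_betw_byWitness[where f' = "\<lambda>S. (S \<inter> prefix_subnets n, S \<inter> middle_subnets n)"])
    show "(\<lambda>S. (S \<inter> prefix_subnets n, S \<inter> middle_subnets n)) ` subnet_selections n 2 2 0 \<subseteq>
      {P. P \<subseteq> prefix_subnets n \<and> card P = 2} \<times> {M. M \<subseteq> middle_subnets n \<and> card M = 2}"
      by (auto simp: subnet_selections_def)
    show "\<forall>S\<in>subnet_selections n 2 2 0.
      (\<lambda>(P, M). P \<union> M) (S \<inter> prefix_subnets n, S \<inter> middle_subnets n) = S"
    proof
      fix S assume S: "S \<in> subnet_selections n 2 2 0"
      \<comment> \<open>An infinite set also has \<open>card\<close> 0, so finiteness, obtained from
        \<open>card S = 4\<close>, is needed to conclude that the suffix part is empty.\<close>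
      then have "finite S" by (intro card_ge_0_finite) (auto simp: subnet_selections_def)
      then have "S \<inter> suffix_subnets n = {}" using S by (auto simp: subnet_selections_def)
      then show "(\<lambda>(P, M). P \<union> M) (S \<inter> prefix_subnets n, S \<inter> middle_subnets n) = S"
        using S by (auto simp: subnet_selections_def)
    qed
    show "\<forall>PM\<in>{P. P \<subseteq> prefix_subnets n \<and> card P = 2} \<times> {M. M \<subseteq> middle_subnets n \<and> card M = 2}.
      (\<lambda>S. (S \<inter> prefix_subnets n, S \<inter> middle_subnets n)) ((\<lambda>(P, M). P \<union> M) PM) = PM"
      using disj by auto
    show "(\<lambda>(P, M). P \<union> M) ` ({P. P \<subseteq> prefix_subnets n \<and> card P = 2} \<times>
      {M. M \<subseteq> middle_subnets n \<and> card M = 2}) \<subseteq> subnet_selections n 2 2 0"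
    proof clarify
      fix P M assume P: "P \<subseteq> prefix_subnets n" "card P = 2" and M: "M \<subseteq> middle_subnets n" "card M = 2"
      have "finite P" "finite M" using P(2) M(2) by (auto intro: card_ge_0_finite)
      moreover have "P \<inter> M = {}" using P M disj by blast
      moreover have "(P \<union> M) \<inter> prefix_subnets n = P" "(P \<union> M) \<inter> middle_subnets n = M"
        "(P \<union> M) \<inter> suffix_subnets n = {}"
        using P M disj by blast+
      ultimately show "P \<union> M \<in> subnet_selections n 2 2 0"
        using P M by (auto simp: subnet_selections_def card_Un_disjoint)
    qed
  qed
qed

text \<open>The factor 1/4 is 1/2 for ordering the two prefix subnetworks times 1/2 for ordering the
  two middle ones. The exponent is the size of the union of all four.\<close>

lemma fault_free_sum_220:
  assumes n: "n \<ge> 4" and p: "0 \<le> p" "p \<le> 1"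
  defines "A \<equiv> distinct_pairs {1..n}"
  shows "fault_free_sum n p 2 2 0 = 1/4 * (\<Sum>x\<in>A. \<Sum>x'\<in>A - {x}. \<Sum>y\<in>A. \<Sum>y'\<in>A - {y}.
    p ^ (4 * fact (n - 2)
      - (overlap x y + overlap x' y + (overlap x y' + overlap x' y')) * fact (n - 3)))"
proof -
  have A: "finite A" by (simp add: A_def)
  let ?pre = "case_prod (prefix_subnet n)" and ?mid = "case_prod (middle_subnet n)"
  let ?PP = "{P. P \<subseteq> ?pre ` A \<and> card P = 2}" and ?MM = "{M. M \<subseteq> ?mid ` A \<and> card M = 2}"
  note inj = inj_on_prefix_subnet[of n, folded A_def] inj_on_middle_subnet[of n, folded A_def]
  have "fault_free_sum n p 2 2 0 = (\<Sum>S\<in>subnet_selections n 2 2 0. p ^ card (\<Union>S))"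
    unfolding fault_free_sum_def
  proof (intro sum.cong refl prob_all_fault_free p)
    fix S assume "S \<in> subnet_selections n 2 2 0"
    then show "\<Union>S \<subseteq> bubble_sort_nodes n"
      by (force simp: subnet_selections_def prefix_subnets_def middle_subnets_def suffix_subnets_def
          prefix_subnet_def middle_subnet_def suffix_subnet_def)
  qed
  also have "\<dots> = (\<Sum>(P, M)\<in>?PP \<times> ?MM. p ^ card (\<Union>(P \<union> M)))"
    using sum.reindex_bij_betw[OF subnet_selections_220[OF n], of "\<lambda>S. p ^ card (\<Union>S)"]
    by (simp add: prefix_subnets_conv_image middle_subnets_conv_image A_def case_prod_unfold)
  also have "\<dots> = (\<Sum>P\<in>?PP. \<Sum>M\<in>?MM. p ^ card (\<Union>(P \<union> M)))"
    using A by (simp add: sum.Sigma[symmetric])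
  also have "\<dots> = 1/4 * (\<Sum>x\<in>A. \<Sum>x'\<in>A - {x}. \<Sum>y\<in>A. \<Sum>y'\<in>A - {y}.
      p ^ card (\<Union>({?pre x, ?pre x'} \<union> {?mid y, ?mid y'})))"
    using A inj n by (simp add: sum_two_subsets_image sum_divide_distrib[symmetric] Un_ac)
  also have "(\<Sum>x\<in>A. \<Sum>x'\<in>A - {x}. \<Sum>y\<in>A. \<Sum>y'\<in>A - {y}.
      p ^ card (\<Union>({?pre x, ?pre x'} \<union> {?mid y, ?mid y'})))
    = (\<Sum>x\<in>A. \<Sum>x'\<in>A - {x}. \<Sum>y\<in>A. \<Sum>y'\<in>A - {y}. p ^ (4 * fact (n - 2)
      - (overlap x y + overlap x' y + (overlap x y' + overlap x' y')) * fact (n - 3)))"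
  proof (intro sum.cong refl)
    fix x x' y y' assume "x \<in> A" "x' \<in> A - {x}" "y \<in> A" "y' \<in> A - {y}"
    then have mem: "x \<in> distinct_pairs {1..n}" "x' \<in> distinct_pairs {1..n}"
        "y \<in> distinct_pairs {1..n}" "y' \<in> distinct_pairs {1..n}" and ne: "x \<noteq> x'" "y \<noteq> y'"
      by (auto simp: A_def)
    have fin: "finite (?pre z)" "finite (?mid z)" for z
      by (cases z; simp add: prefix_subnet_def middle_subnet_def)+
    have "\<Union>({?pre x, ?pre x'} \<union> {?mid y, ?mid y'}) = ?pre x \<union> ?pre x' \<union> (?mid y \<union> ?mid y')"
      by auto
    moreover have "4 * m = m + m + m + m" for m :: nat by simp
    with n mem have "card (?pre x \<union> ?pre x' \<union> (?mid y \<union> ?mid y')) = 4 * fact (n - 2)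
      - (overlap x y + overlap x' y + (overlap x y' + overlap x' y')) * fact (n - 3)"
      by (simp only: card_Un_two_pairs[OF fin(1) fin(1) fin(2) fin(2)
          prefix_subnets_disjoint[OF ne(1)] middle_subnets_disjoint[OF ne(2)]])
        (simp add: card_prefix_subnet card_middle_subnet card_prefix_Int_middle distrib_right)
    ultimately show "p ^ card (\<Union>({?pre x, ?pre x'} \<union> {?mid y, ?mid y'})) = p ^ (4 * fact (n - 2)
      - (overlap x y + overlap x' y + (overlap x y' + overlap x' y')) * fact (n - 3))"
      by (simp only:)
  qed
  finally show ?thesis .
qed

theorem theorem6:
  fixes n :: nat and p :: real
  assumes "n \<ge> 4" and "0 \<le> p" and "p \<le> 1"
  shows "fault_free_sum n p 2 2 0 =
      1/4 * (real n ^ 8 - 8 * real n ^ 7 + 30 * real n ^ 6 - 69 * real n ^ 5 + 104 * real n ^ 4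
               - 99 * real n ^ 3 + 53 * real n ^ 2 - 12 * real n)
          * p ^ (4 * fact (n - 2))
    + (real n ^ 7 - 8 * real n ^ 6 + 29 * real n ^ 5 - 59 * real n ^ 4 + 68 * real n ^ 3
               - 41 * real n ^ 2 + 10 * real n)
          * p ^ (4 * fact (n - 2) - fact (n - 3))
    + 1/2 * (3 * real n ^ 6 - 23 * real n ^ 5 + 67 * real n ^ 4 - 92 * real n ^ 3
               + 59 * real n ^ 2 - 14 * real n)
          * p ^ (4 * fact (n - 2) - 2 * fact (n - 3))
    + (real n ^ 4 - 6 * real n ^ 3 + 11 * real n ^ 2 - 6 * real n)
          * p ^ (4 * fact (n - 2) - 3 * fact (n - 3))
    + 1/4 * (real n ^ 5 - 10 * real n ^ 4 + 35 * real n ^ 3 - 50 * real n ^ 2 + 24 * real n)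
          * p ^ (4 * fact (n - 2) - 4 * fact (n - 3))"
proof -
  have "finite {1..n}" "card {1..n} \<ge> 3" using assms(1) by auto
  \<comment> \<open>The weight of \<open>e\<close> overlaps is the corresponding power of
    \<open>p\<close>. The stated coefficients are those of \<open>w 0\<close> to \<open>w 4\<close>,
    multiplied out and divided by 4; for instance, \<open>w 3\<close> gets n(n-1)(n-2)(n-3).\<close>
  from sum_overlap[OF this, of "\<lambda>e. p ^ (4 * fact (n - 2) - e * fact (n - 3))"]
  show ?thesis
    unfolding fault_free_sum_220[OF assms]
    by (simp add: field_simps power2_eq_square power_numeral_reduce)
qed

end
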